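(* Let $P\subset\mathbb{R}^d$ be a lattice polytope of dimension $d\ge1$. For every $k\ge1$ there exists a scaling $c\in(\mathbb{C}^* )^N$, where $N$ is the number of lattice points of $\mathcal{A}^k(P)$, such that the scaled model of $\mathcal{A}^k(P)$ has ML degree $\mathrm{mldeg}(P)$; that is, $\mathrm{mldeg}(V_{A_k}^c)=\mathrm{mldeg}(P)$, where $A_k$ is the design matrix of $\mathcal{A}^k(P)$.
   Context: $\mathcal{A}(P) := P\times[-1,1]$, and $\mathcal{A}^k(P)$ is the $(d+k)$-dimensional polytope obtained by applying $\mathcal{A}$ exactly $k$ times. For a lattice polytope $P\subset\mathbb{R}^d$ with lattice points $P\cap\mathbb{Z}^d=\{a_1,\dots,a_n\}$, the design matrix is $A=[a_1\ \cdots\ a_n]\in\mathbb{Z}^{d\times n}$, and $A'$ is $A$ with an additional first row of ones. For a scaling $c\in(\mathbb{C}^* )^n$, the scaled toric variety $V_A^c\subseteq\mathbb{C}^n$ is the Zariski closure of the image of $\psi_A^c:(\mathbb{C}^* )^{d+1}\to(\mathbb{C}^* )^n$, $(s,\theta)\mapsto(c_1s\theta^{a_1},\dots,c_ns\theta^{a_n})$. For data $u\in\mathbb{N}^n$ with $u_+=\sum_iu_i$, the score equations are $A'p=\frac1{u_+}A'u$ with $p\in V_A^c\cap(\mathbb{C}^* )^n$, and $\mathrm{mldeg}(V_A^c)$ is the number of complex solutions $p$ for generic $u$. $\mathrm{mldeg}(P)$ denotes $\mathrm{mldeg}(V_A^{(1,\dots,1)})$, the ML degree for the standard scaling. *)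

theory Defs
  imports "HOL-Analysis.Analysis" "HOL-Library.Function_Algebras"
begin

section \<open>Coordinate spaces of varying dimension\<close>

text \<open>
  The dimension of the ambient space changes with the number of prism steps, so $F^n$ is not
  rendered by a type: it is the set of sequences over $F$ that vanish from index $n$ on, with
  coordinates numbered $0,\dots,n-1$.  With the pointwise real vector space structure below, the
  library notions of convex hull, affine hull and affine dependence apply to its subsets.
\<close>

definition coord_space :: "nat \<Rightarrow> (nat \<Rightarrow> 'a::zero) set" where
  "coord_space n = {x. \<forall>i\<ge>n. x i = 0}"

instantiation "fun" :: (type, real_vector) real_vector
begin

definition scaleR_fun :: "real \<Rightarrow> ('a \<Rightarrow> 'b) \<Rightarrow> 'a \<Rightarrow> 'b" where
  "scaleR_fun r f = (\<lambda>x. r *\<^sub>R f x)"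

instance
  by standard (simp_all add: scaleR_fun_def plus_fun_def scaleR_add_right scaleR_add_left)

end


section \<open>Lattice polytopes and iterated prisms\<close>

definition lattice :: "nat \<Rightarrow> (nat \<Rightarrow> real) set" where
  "lattice d = {x \<in> coord_space d. \<forall>i<d. x i \<in> \<int>}"

definition lattice_polytope :: "nat \<Rightarrow> (nat \<Rightarrow> real) set \<Rightarrow> bool" where
  "lattice_polytope d P \<longleftrightarrow> (\<exists>V. finite V \<and> V \<subseteq> lattice d \<and> P = convex hull V)"

text \<open>
  The defining property of \<^const>\<open>aff_dim\<close>, which the library only provides for Euclidean spaces.
\<close>

definition has_aff_dim :: "'a::real_vector set \<Rightarrow> nat \<Rightarrow> bool" where
  "has_aff_dim P m \<longleftrightarrow>
     (\<exists>B. affine hull B = affine hull P \<and> \<not> affine_dependent B \<and> card B = m + 1)"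

definition prism :: "nat \<Rightarrow> (nat \<Rightarrow> real) set \<Rightarrow> (nat \<Rightarrow> real) set" where
  "prism d P = {x(d := t) | x t. x \<in> P \<and> t \<in> {-1..1}}"

primrec iterated_prism :: "nat \<Rightarrow> nat \<Rightarrow> (nat \<Rightarrow> real) set \<Rightarrow> (nat \<Rightarrow> real) set" where
  "iterated_prism d 0 P = P"
| "iterated_prism d (Suc k) P = prism (d + k) (iterated_prism d k P)"


section \<open>Design matrices\<close>

text \<open>
  A matrix is given by its entries \<open>A i j\<close> (row \<open>i\<close>, column \<open>j\<close>), which matter only for \<open>i < d\<close>
  and \<open>j < n\<close>.  The predicate says that the columns list every lattice point of \<open>P\<close> exactly once;
  in particular \<open>n\<close> is the number of lattice points.
\<close>

definition is_design_matrix ::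
  "nat \<Rightarrow> nat \<Rightarrow> (nat \<Rightarrow> nat \<Rightarrow> int) \<Rightarrow> (nat \<Rightarrow> real) set \<Rightarrow> bool" where
  "is_design_matrix d n A P \<longleftrightarrow>
     bij_betw (\<lambda>j i. if i < d then real_of_int (A i j) else 0) {..<n} (P \<inter> lattice d)"

definition add_ones_row :: "(nat \<Rightarrow> nat \<Rightarrow> int) \<Rightarrow> nat \<Rightarrow> nat \<Rightarrow> int" where
  "add_ones_row A i j = (case i of 0 \<Rightarrow> 1 | Suc i' \<Rightarrow> A i' j)"


section \<open>Zariski closure and genericity\<close>

inductive_set polynomial_functions :: "nat \<Rightarrow> ((nat \<Rightarrow> complex) \<Rightarrow> complex) set" for n :: nat where
  const: "(\<lambda>x. a) \<in> polynomial_functions n"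
| coord: "i < n \<Longrightarrow> (\<lambda>x. x i) \<in> polynomial_functions n"
| add: "f \<in> polynomial_functions n \<Longrightarrow> g \<in> polynomial_functions n \<Longrightarrow>
    (\<lambda>x. f x + g x) \<in> polynomial_functions n"
| mult: "f \<in> polynomial_functions n \<Longrightarrow> g \<in> polynomial_functions n \<Longrightarrow>
    (\<lambda>x. f x * g x) \<in> polynomial_functions n"

definition zariski_closure :: "nat \<Rightarrow> (nat \<Rightarrow> complex) set \<Rightarrow> (nat \<Rightarrow> complex) set" where
  "zariski_closure n S =
     {x \<in> coord_space n. \<forall>f \<in> polynomial_functions n. (\<forall>y\<in>S. f y = 0) \<longrightarrow> f x = 0}"

text \<open>
  A property of data vectors in $\mathbb{N}^n$ holds generically if it holds off some hypersurface
  of $\mathbb{C}^n$.  As $\mathbb{N}^n$ is Zariski dense in $\mathbb{C}^n$, two incompatible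
  properties cannot both hold generically.
\<close>

definition generically :: "nat \<Rightarrow> ((nat \<Rightarrow> nat) \<Rightarrow> bool) \<Rightarrow> bool" where
  "generically n Q \<longleftrightarrow>
     (\<exists>f \<in> polynomial_functions n. (\<exists>x \<in> coord_space n. f x \<noteq> 0) \<and>
        (\<forall>u \<in> coord_space n. f (\<lambda>i. of_nat (u i)) \<noteq> 0 \<longrightarrow> Q u))"


section \<open>Scaled toric varieties and maximum likelihood degree\<close>

definition torus :: "nat \<Rightarrow> (nat \<Rightarrow> complex) set" where
  "torus n = {x \<in> coord_space n. \<forall>i<n. x i \<noteq> 0}"

definition monomial_map ::
  "nat \<Rightarrow> nat \<Rightarrow> (nat \<Rightarrow> nat \<Rightarrow> int) \<Rightarrow> (nat \<Rightarrow> complex) \<Rightarrow>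
   complex \<times> (nat \<Rightarrow> complex) \<Rightarrow> nat \<Rightarrow> complex" where
  "monomial_map d n A c = (\<lambda>(s, \<theta>) j.
     if j < n then c j * s * (\<Prod>i<d. \<theta> i powi A i j) else 0)"

definition scaled_toric_variety ::
  "nat \<Rightarrow> nat \<Rightarrow> (nat \<Rightarrow> nat \<Rightarrow> int) \<Rightarrow> (nat \<Rightarrow> complex) \<Rightarrow> (nat \<Rightarrow> complex) set" where
  "scaled_toric_variety d n A c =
     zariski_closure n (monomial_map d n A c ` ((- {0}) \<times> torus d))"

definition score_solutions ::
  "nat \<Rightarrow> nat \<Rightarrow> (nat \<Rightarrow> nat \<Rightarrow> int) \<Rightarrow> (nat \<Rightarrow> complex) \<Rightarrow> (nat \<Rightarrow> nat) \<Rightarrow> (nat \<Rightarrow> complex) set" where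
  "score_solutions d n A c u =
     {p \<in> scaled_toric_variety d n A c \<inter> torus n.
        \<forall>i<d+1. (\<Sum>j<n. of_int (add_ones_row A i j) * p j) =
          1 / of_nat (\<Sum>j<n. u j) * (\<Sum>j<n. of_int (add_ones_row A i j) * of_nat (u j))}"

definition mldeg :: "nat \<Rightarrow> nat \<Rightarrow> (nat \<Rightarrow> nat \<Rightarrow> int) \<Rightarrow> (nat \<Rightarrow> complex) \<Rightarrow> nat" where
  "mldeg d n A c =
     (THE m. generically n (\<lambda>u. finite (score_solutions d n A c u) \<and>
                                card (score_solutions d n A c u) = m))"

definition standard_scaling :: "nat \<Rightarrow> nat \<Rightarrow> complex" where
  "standard_scaling n = (\<lambda>j. if j < n then 1 else 0)"

end

theory Submission
  imports Defs
begin

text \<open>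
  One prism step suffices, as the steps can be iterated.  The lattice points of $Q\times[-1,1]$ are
  $(a_i,e)$ with $a_i$ a lattice point of $Q$ and $e\in\{-1,0,1\}$.  Given a scaling $c$ for $Q$,
  take the scaling $c_i, 2c_i, c_i$ on the three points above $a_i$.  The sum of the three
  coordinates of the parametrisation above $a_i$ is then
  \[ c_i s\theta^{a_i}(\tau^{-1}+2+\tau) = c_i s\theta^{a_i}\,\frac{(1+\tau)^2}{\tau}, \]
  so the factor that depends on the new parameter $\tau$ is common to all $i$ and is absorbed into
  $s$.  Consequently summing over the fibres maps solutions of the score equations of the prism with
  data $u$ to solutions for $Q$ with the fibre sums of $u$ as data.  The only further equation, that of
  the new row, reads $(\tau-1)/(\tau+1)=v$ with $v=\sum_j e_ju_j/u_+$, where $e_j$ is the last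
  coordinate of the $j$-th lattice point.  It determines $\tau$, and with it the way a
  solution for $Q$ is distributed over the fibres: in the proportions $a^2, 2ab, b^2$
  with $a=(1+v)/2$ and $b=(1-v)/2$ for $e=1,0,-1$.  So the two solution sets are in bijection
  (\<open>bij_betw_score_solutions_prism\<close>) for all data with positive entries.

  The points of the scaled toric variety are handled through its definition as a Zariski closure:
  polynomial maps that respect the parametrised points respect their closures
  (\<open>zariski_closure_image\<close>), and the binomials vanishing on the parametrised points of the
  prism produce $\tau$ for every point of the closure with nonzero coordinates.

  It remains to compare genericity on the two data spaces (\<open>generically_marginal_iff\<close>), which works
  because the solution set depends on the data only up to scaling.  This shows, for each number $m$,
  that generically there are exactly $m$ solutions on one side if and only if this holds on
  the other side, and hence that the ML degrees agree.
\<close>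

section \<open>Polynomial functions and genericity\<close>

lemma polynomial_functions_cong:
  assumes "f \<in> polynomial_functions n" "\<And>i. i < n \<Longrightarrow> x i = y i"
  shows "f x = f y"
  using assms by (induction rule: polynomial_functions.induct) auto

lemma polynomial_functions_compose:
  assumes "f \<in> polynomial_functions m" "\<And>j. j < m \<Longrightarrow> (\<lambda>x. G x j) \<in> polynomial_functions n"
  shows "(\<lambda>x. f (G x)) \<in> polynomial_functions n"
  using assms
  by (induction rule: polynomial_functions.induct) (auto intro: polynomial_functions.intros)

lemma polynomial_functions_scale_coord:
  "i < n \<Longrightarrow> (\<lambda>x. a * x i) \<in> polynomial_functions n"
  by (intro polynomial_functions.intros)

lemma polynomial_functions_diff:
  assumes "f \<in> polynomial_functions n" "g \<in> polynomial_functions n"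
  shows "(\<lambda>x. f x - g x) \<in> polynomial_functions n"
proof -
  have "(\<lambda>x. f x + (- 1) * g x) \<in> polynomial_functions n"
    using assms by (intro polynomial_functions.intros)
  then show ?thesis by simp
qed

lemma polynomial_functions_sum:
  assumes "\<And>j. j \<in> S \<Longrightarrow> (\<lambda>x. g j x) \<in> polynomial_functions n"
  shows "(\<lambda>x. \<Sum>j\<in>S. g j x) \<in> polynomial_functions n"
  using assms
  by (induction S rule: infinite_finite_induct) (auto intro: polynomial_functions.intros)

lemma polynomial_functions_prod:
  assumes "\<And>j. j \<in> S \<Longrightarrow> (\<lambda>x. g j x) \<in> polynomial_functions n"
  shows "(\<lambda>x. \<Prod>j\<in>S. g j x) \<in> polynomial_functions n"
  using assms
  by (induction S rule: infinite_finite_induct) (auto intro: polynomial_functions.intros)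

lemma polynomial_function_along_line:
  assumes "f \<in> polynomial_functions n"
  shows "\<exists>p. \<forall>t. f (\<lambda>i. x i + t * y i) = poly p t"
  using assms
proof (induction rule: polynomial_functions.induct)
  case (const a)
  show ?case by (rule exI[of _ "[:a:]"]) simp
next
  case (coord i)
  show ?case by (rule exI[of _ "[:x i, y i:]"]) simp
next
  case (add f g)
  then obtain p q where "\<forall>t. f (\<lambda>i. x i + t * y i) = poly p t" "\<forall>t. g (\<lambda>i. x i + t * y i) = poly q t"
    by blast
  then show ?case by (intro exI[of _ "p + q"]) simp
next
  case (mult f g)
  then obtain p q where "\<forall>t. f (\<lambda>i. x i + t * y i) = poly p t" "\<forall>t. g (\<lambda>i. x i + t * y i) = poly q t"
    by blast
  then show ?case by (intro exI[of _ "p * q"]) simp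
qed

text \<open>
  Zariski density of the positive integer vectors: the coordinates of a point off the hypersurface
  are made positive integers one at a time, since along a coordinate line a polynomial that does
  not vanish identically has only finitely many zeros.
\<close>

lemma polynomial_function_nonzero_at_positive_nat:
  assumes f: "f \<in> polynomial_functions n" and "f x \<noteq> 0"
  obtains u :: "nat \<Rightarrow> nat"
  where "u \<in> coord_space n" "\<And>i. i < n \<Longrightarrow> u i > 0" "f (\<lambda>i. of_nat (u i)) \<noteq> 0"
proof -
  have "\<exists>y. f y \<noteq> 0 \<and> (\<forall>j<m. \<exists>k>0. y j = of_nat k)" for m
  proof (induction m)
    case 0
    then show ?case using assms by auto
  next
    case (Suc m)
    then obtain y where y: "f y \<noteq> 0" "\<forall>j<m. \<exists>k>0. y j = of_nat k" by blast
    obtain p where p: "\<And>t. f (\<lambda>i. y i + t * (if i = m then 1 else 0)) = poly p t"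
      using polynomial_function_along_line[OF f, of y "\<lambda>i. if i = m then 1 else 0"] by blast
    have "p \<noteq> 0" using p[of 0] y(1) by auto
    then have "finite {t. poly p t = 0}" by (rule poly_roots_finite)
    moreover have "infinite ((\<lambda>k. of_nat k - y m) ` {0::nat<..})"
      by (subst finite_image_iff) (auto simp: inj_on_def infinite_Ioi)
    ultimately have "\<not> (\<lambda>k. of_nat k - y m) ` {0::nat<..} \<subseteq> {t. poly p t = 0}"
      using finite_subset by blast
    then obtain k :: nat where k: "k > 0" "poly p (of_nat k - y m) \<noteq> 0" by auto
    let ?y = "\<lambda>i. y i + (of_nat k - y m) * (if i = m then 1 else 0)"
    have "\<forall>j<Suc m. \<exists>k>0. ?y j = of_nat k"
      using y(2) k(1) by (auto simp: less_Suc_eq)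
    moreover have "f ?y \<noteq> 0" using p k by simp
    ultimately show ?case by blast
  qed
  from this[of n] obtain y k
    where y: "f y \<noteq> 0" "\<And>j. j < n \<Longrightarrow> k j > (0::nat) \<and> y j = of_nat (k j)" by metis
  show thesis
  proof
    show "(\<lambda>i. if i < n then k i else 0) \<in> coord_space n" by (simp add: coord_space_def)
    have "f (\<lambda>i. of_nat (if i < n then k i else 0)) = f y"
      by (rule polynomial_functions_cong[OF f]) (simp add: y)
    then show "f (\<lambda>i. of_nat (if i < n then k i else 0)) \<noteq> 0" using y by simp
  qed (use y in auto)
qed

text \<open>
  The polynomial that witnesses genericity may be multiplied by the product of the coordinates, so
  only positive data matter; by the previous lemma the product still does not vanish identically.
\<close>

lemma generically_positiveI:
  assumes f: "f \<in> polynomial_functions n" and "f x \<noteq> 0"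
    and Q: "\<And>u. u \<in> coord_space n \<Longrightarrow> (\<And>i. i < n \<Longrightarrow> u i > 0) \<Longrightarrow> f (\<lambda>i. of_nat (u i)) \<noteq> 0 \<Longrightarrow> Q u"
  shows "generically n Q"
proof -
  let ?g = "\<lambda>x. f x * (\<Prod>i<n. x i)"
  obtain u :: "nat \<Rightarrow> nat"
    where u: "u \<in> coord_space n" "\<And>i. i < n \<Longrightarrow> u i > 0" "f (\<lambda>i. of_nat (u i)) \<noteq> 0"
    using polynomial_function_nonzero_at_positive_nat[OF assms(1,2)] by blast
  have "?g \<in> polynomial_functions n"
    using f by (intro polynomial_functions.intros polynomial_functions_prod) auto
  moreover have "(\<lambda>i. of_nat (u i)) \<in> coord_space n \<and> ?g (\<lambda>i. of_nat (u i)) \<noteq> 0"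
    using u by (auto simp: coord_space_def)
  moreover have "Q w" if "w \<in> coord_space n" "?g (\<lambda>i. of_nat (w i)) \<noteq> 0" for w
    using that by (intro Q) auto
  ultimately show ?thesis
    unfolding generically_def by (intro bexI[of _ ?g] conjI bexI[of _ "\<lambda>i. of_nat (u i)"]) auto
qed


section \<open>Solutions of the score equations\<close>

text \<open>
  The right-hand sides of the score equations depend on the data only through $u/u_+$.
\<close>

lemma score_solutions_scale:
  assumes "M > 0"
  shows "score_solutions d n A c (\<lambda>i. M * u i) = score_solutions d n A c u"
proof -
  have "1 / of_nat (\<Sum>j<n. M * u j) * (\<Sum>j<n. of_int (a j) * of_nat (M * u j)) =
      (1 / of_nat (\<Sum>j<n. u j) * (\<Sum>j<n. of_int (a j) * of_nat (u j)) :: complex)" for a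
  proof -
    have "(\<Sum>j<n. M * u j) = M * (\<Sum>j<n. u j)" by (simp add: sum_distrib_left)
    moreover have "(\<Sum>j<n. of_int (a j) * of_nat (M * u j)) =
        (of_nat M * (\<Sum>j<n. of_int (a j) * of_nat (u j)) :: complex)"
      by (simp add: sum_distrib_left mult_ac)
    ultimately show ?thesis using assms by simp
  qed
  then show ?thesis unfolding score_solutions_def by simp
qed

lemma zariski_closure_vanish:
  "x \<in> zariski_closure n S \<Longrightarrow> f \<in> polynomial_functions n \<Longrightarrow> (\<And>y. y \<in> S \<Longrightarrow> f y = 0) \<Longrightarrow> f x = 0"
  by (auto simp: zariski_closure_def)

lemma zariski_closure_image:
  assumes x: "x \<in> zariski_closure n S" and "G x \<in> coord_space m"
    and G: "\<And>j. j < m \<Longrightarrow> (\<lambda>x. G x j) \<in> polynomial_functions n"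
    and "\<And>y. y \<in> S \<Longrightarrow> G y \<in> T"
  shows "G x \<in> zariski_closure m T"
  unfolding zariski_closure_def
proof (intro CollectI conjI ballI impI)
  fix f assume f: "f \<in> polynomial_functions m" "\<forall>y\<in>T. f y = 0"
  have "(\<lambda>x. f (G x)) \<in> polynomial_functions n"
    using f(1) G by (rule polynomial_functions_compose)
  moreover have "f (G y) = 0" if "y \<in> S" for y
    using assms(4)[OF that] by (rule bspec[OF f(2)])
  ultimately show "f (G x) = 0"
    by (rule zariski_closure_vanish[OF x, of "\<lambda>x. f (G x)"])
qed (rule assms(2))


section \<open>The design matrix of a prism\<close>

text \<open>
  The columns of the design matrix of a prism may come in any order; column \<open>j\<close> is the
  lattice point at height \<open>level j\<close> above column \<open>base j\<close> of the design matrix of the base.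
\<close>

locale prism_design =
  fixes D n N :: nat and A B :: "nat \<Rightarrow> nat \<Rightarrow> int" and base :: "nat \<Rightarrow> nat" and level :: "nat \<Rightarrow> int"
  assumes columns: "bij_betw (\<lambda>j. (base j, level j)) {..<N} ({..<n} \<times> {-1, 0, 1})"
    and lower_rows: "i < D \<Longrightarrow> j < N \<Longrightarrow> B i j = A i (base j)"
    and last_row: "j < N \<Longrightarrow> B D j = level j"
begin

definition col :: "nat \<Rightarrow> int \<Rightarrow> nat" where
  "col i e = inv_into {..<N} (\<lambda>j. (base j, level j)) (i, e)"

lemma base_less: "j < N \<Longrightarrow> base j < n"
  and level_cases: "j < N \<Longrightarrow> level j \<in> {-1, 0, 1}"
  using columns by (auto simp: bij_betw_def)

lemma
  assumes "i < n" "e \<in> {-1, 0, 1}"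
  shows col_less: "col i e < N" and base_col: "base (col i e) = i" and level_col: "level (col i e) = e"
proof -
  have *: "(i, e) \<in> (\<lambda>j. (base j, level j)) ` {..<N}"
    using columns assms by (auto simp: bij_betw_def)
  show "col i e < N" using inv_into_into[OF *] by (simp add: col_def)
  show "base (col i e) = i" "level (col i e) = e"
    using f_inv_into_f[OF *] by (simp_all add: col_def)
qed

lemma col_base_level: "j < N \<Longrightarrow> col (base j) (level j) = j"
  unfolding col_def using columns
  by (intro inv_into_f_eq) (auto simp: bij_betw_def)

definition marginal :: "(nat \<Rightarrow> 'a::comm_monoid_add) \<Rightarrow> nat \<Rightarrow> 'a" where
  "marginal x i = (\<Sum>j | j < N \<and> base j = i. x j)"

lemma marginal_fibre:
  assumes "i < n"
  shows "marginal x i = x (col i (-1)) + x (col i 0) + x (col i 1)"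
proof -
  have "{j. j < N \<and> base j = i} = {col i (-1), col i 0, col i 1}"
  proof (intro equalityI subsetI)
    fix j assume "j \<in> {j. j < N \<and> base j = i}"
    then show "j \<in> {col i (-1), col i 0, col i 1}"
      using col_base_level[of j] level_cases[of j] by auto
  qed (use assms col_less base_col in auto)
  moreover have "col i (-1) \<noteq> col i 0" "col i (-1) \<noteq> col i 1" "col i 0 \<noteq> col i 1"
    using level_col[OF assms] by (metis insertI1 insert_iff one_neq_neg_one zero_neq_neg_one zero_neq_one)+
  ultimately show ?thesis by (simp add: marginal_def add.assoc)
qed

lemma marginal_coord_space: "marginal x \<in> coord_space n"
proof -
  have "marginal x i = 0" if "i \<ge> n" for i
  proof -
    have "{j. j < N \<and> base j = i} = {}" using base_less that by fastforce
    then show ?thesis unfolding marginal_def by (simp only: sum.empty)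
  qed
  then show ?thesis by (simp add: coord_space_def)
qed

lemma of_nat_marginal: "of_nat (marginal u i) = marginal (\<lambda>j. of_nat (u j)) i"
  by (simp add: marginal_def)

lemma sum_marginal:
  fixes x :: "nat \<Rightarrow> 'a::comm_semiring_1"
  shows "(\<Sum>i<n. g i * marginal x i) = (\<Sum>j<N. g (base j) * x j)"
proof -
  have "(\<Sum>j<N. g (base j) * x j) = (\<Sum>i<n. \<Sum>j | j \<in> {..<N} \<and> base j = i. g (base j) * x j)"
    using base_less by (intro sum.group[symmetric]) auto
  also have "\<dots> = (\<Sum>i<n. g i * marginal x i)"
    by (simp add: marginal_def sum_distrib_left)
  finally show ?thesis by simp
qed

lemma sum_marginal_1:
  fixes x :: "nat \<Rightarrow> 'a::comm_semiring_1"
  shows "(\<Sum>i<n. marginal x i) = (\<Sum>j<N. x j)"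
  using sum_marginal[of "\<lambda>_. 1" x] by simp

text \<open>
  Genericity passes to the marginal data in both directions.  Downwards, a polynomial that is
  nonzero on $\mathbb{C}^N$ must yield a condition on the marginal alone; the vectors
  $u_j = \lambda_j w_{\mathrm{base}(j)}$ with fixed positive integers $\lambda_j$ serve as test
  data, provided that the sums of $\lambda$ over the fibres all agree, so that the marginal of $u$
  is a multiple of $w$.
\<close>

lemma generically_marginal_iff:
  assumes scale: "\<And>M w. M > 0 \<Longrightarrow> Q (\<lambda>i. M * w i) = Q w"
    and Q: "\<And>u. u \<in> coord_space N \<Longrightarrow> (\<And>j. j < N \<Longrightarrow> u j > 0) \<Longrightarrow> R u = Q (marginal u)"
  shows "generically N R \<longleftrightarrow> generically n Q"
proof
  assume "generically n Q"
  then obtain f x where f: "f \<in> polynomial_functions n" and x: "f x \<noteq> 0"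
    and fQ: "\<And>u. u \<in> coord_space n \<Longrightarrow> f (\<lambda>i. of_nat (u i)) \<noteq> 0 \<Longrightarrow> Q u"
    unfolding generically_def by blast
  let ?x = "\<lambda>j. if level j = 0 then x (base j) else 0"
  show "generically N R"
  proof (rule generically_positiveI)
    show "(\<lambda>y. f (marginal y)) \<in> polynomial_functions N"
      unfolding marginal_def
      by (intro polynomial_functions_compose[OF f] polynomial_functions_sum polynomial_functions.coord) auto
    have "f (marginal ?x) = f x"
      by (intro polynomial_functions_cong[OF f]) (simp add: marginal_fibre level_col base_col)
    then show "f (marginal ?x) \<noteq> 0" using x by simp
    show "R u" if "u \<in> coord_space N" "\<And>i. i < N \<Longrightarrow> 0 < u i"
      "f (marginal (\<lambda>i. of_nat (u i))) \<noteq> 0" for u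
      using that fQ[OF marginal_coord_space, of u] Q by (simp add: of_nat_marginal)
  qed
next
  assume "generically N R"
  then obtain f x where f: "f \<in> polynomial_functions N" and x: "f x \<noteq> 0"
    and fR: "\<And>u. u \<in> coord_space N \<Longrightarrow> f (\<lambda>i. of_nat (u i)) \<noteq> 0 \<Longrightarrow> R u"
    unfolding generically_def by blast
  obtain v :: "nat \<Rightarrow> nat"
    where v: "v \<in> coord_space N" "\<And>i. i < N \<Longrightarrow> v i > 0" "f (\<lambda>i. of_nat (v i)) \<noteq> 0"
    using polynomial_function_nonzero_at_positive_nat[OF f x] by blast
  define W where "W = (\<Prod>i<n. marginal v i)"
  define rest where "rest i = (\<Prod>l\<in>{..<n} - {i}. marginal v l)" for i
  have marg_pos: "marginal v i > 0" if "i < n" for i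
    using v(2) col_less[OF that, of 0] by (simp add: marginal_fibre[OF that])
  have rest_pos: "rest i > 0" for i
    using marg_pos by (simp add: rest_def)
  have W_pos: "W > 0" using marg_pos by (simp add: W_def)
  have W_rest: "marginal v i * rest i = W" if "i < n" for i
    using that by (simp add: W_def rest_def prod.remove)
  \<comment> \<open>The factor \<open>rest\<close> is what equalises the fibre sums: all of them become \<open>W\<close>.\<close>
  let ?u = "\<lambda>w j. of_nat (v j * rest (base j)) * w (base j)"
  show "generically n Q"
  proof (rule generically_positiveI)
    show "(\<lambda>w. f (?u w)) \<in> polynomial_functions n"
      using base_less by (intro polynomial_functions_compose[OF f] polynomial_functions_scale_coord)
    let ?w = "\<lambda>i. of_nat (marginal v i) / of_nat W"
    have "f (?u ?w) = f (\<lambda>j. of_nat (v j))"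
    proof (rule polynomial_functions_cong[OF f])
      fix j assume "j < N"
      then have "of_nat (marginal v (base j)) * of_nat (rest (base j)) = (of_nat W :: complex)"
        using W_rest[OF base_less] by (simp flip: of_nat_mult)
      then show "?u ?w j = (of_nat (v j) :: complex)" using W_pos by (simp add: field_simps)
    qed
    then show "f (?u ?w) \<noteq> 0" using v by simp
  next
    fix w :: "nat \<Rightarrow> nat"
    assume w: "w \<in> coord_space n" "\<And>i. i < n \<Longrightarrow> 0 < w i"
      and fw: "f (?u (\<lambda>i. of_nat (w i))) \<noteq> 0"
    have u: "?u w \<in> coord_space N" using v(1) by (simp add: coord_space_def)
    have "f (\<lambda>j. of_nat (?u w j)) \<noteq> 0" using fw by simp
    then have "R (?u w)" by (rule fR[OF u])
    moreover have "?u w j > 0" if "j < N" for j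
      using v(2)[OF that] rest_pos w(2)[OF base_less[OF that]] by simp
    ultimately have "Q (marginal (?u w))" using Q[OF u] by blast
    moreover have "marginal (?u w) = (\<lambda>i. W * w i)"
    proof
      fix i
      show "marginal (?u w) i = W * w i"
      proof (cases "i < n")
        case True
        have "marginal (?u w) i = marginal v i * rest i * w i"
          by (simp add: marginal_def sum_distrib_right)
        then show ?thesis using W_rest[OF True] by simp
      next
        case False
        then show ?thesis using w(1) marginal_coord_space[of "?u w"] by (simp add: coord_space_def)
      qed
    qed
    ultimately show "Q w" using scale[OF W_pos] by simp
  qed
qed


section \<open>The scaled toric variety of a prism\<close>

text \<open>
  With the weights $1, 2, 1$ the fibre sum of the powers $\tau^e$ is $(1+\tau)^2/\tau$.  Its only
  zero is $\tau=-1$, where all fibre sums vanish and hence cannot add up to $1$; and it makes the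
  equation of the new row linear in $\tau$ after division by the total, so that $\tau$ is unique.
\<close>

definition prism_scaling :: "(nat \<Rightarrow> complex) \<Rightarrow> nat \<Rightarrow> complex" where
  "prism_scaling c j = (if j < N then (if level j = 0 then 2 else 1) * c (base j) else 0)"

lemma prism_scaling_torus: "c \<in> torus n \<Longrightarrow> prism_scaling c \<in> torus N"
  using base_less by (auto simp: torus_def coord_space_def prism_scaling_def)

lemma monomial_map_prism:
  assumes "j < N"
  shows "monomial_map (Suc D) N B (prism_scaling c) (s, \<theta>) j =
    (if level j = 0 then 2 else 1) * \<theta> D powi level j * monomial_map D n A c (s, \<theta>(D := 0)) (base j)"
  using assms base_less
  by (simp add: monomial_map_def prism_scaling_def lower_rows last_row)

text \<open>
  For nonzero coordinates these binomials say that, after division by the weights $1, 2, 1$, the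
  ratio of level $1$ to level $0$ equals that of level $0$ to level $-1$ and is the same in all
  fibres.  This common ratio is the parameter $\tau$ of a point of the closure.
\<close>

lemma prism_toric_fibre:
  assumes p: "p \<in> scaled_toric_variety (Suc D) N B (prism_scaling c)" and i: "i < n" and l: "l < n"
  shows "4 * p (col i 1) * p (col i (-1)) = (p (col i 0))\<^sup>2"
    and "p (col i 1) * p (col l 0) = p (col l 1) * p (col i 0)"
proof -
  note cols = col_less[OF i] col_less[OF l]
  note facts = col_less base_col level_col i l
  have "4 * p (col i 1) * p (col i (-1)) - p (col i 0) * p (col i 0) = 0"
  proof (rule zariski_closure_vanish[OF p[unfolded scaled_toric_variety_def]])
    show "(\<lambda>p. 4 * p (col i 1) * p (col i (-1)) - p (col i 0) * p (col i 0)) \<in> polynomial_functions N"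
      using cols by (intro polynomial_functions_diff polynomial_functions.intros) auto
    fix y assume "y \<in> monomial_map (Suc D) N B (prism_scaling c) ` ((- {0}) \<times> torus (Suc D))"
    then obtain s \<theta> where "\<theta> \<in> torus (Suc D)" "y = monomial_map (Suc D) N B (prism_scaling c) (s, \<theta>)"
      by auto
    then show "4 * y (col i 1) * y (col i (-1)) - y (col i 0) * y (col i 0) = 0"
      by (simp add: monomial_map_prism facts torus_def power_int_minus)
  qed
  then show "4 * p (col i 1) * p (col i (-1)) = (p (col i 0))\<^sup>2" by (simp add: power2_eq_square)
  have "p (col i 1) * p (col l 0) - p (col l 1) * p (col i 0) = 0"
  proof (rule zariski_closure_vanish[OF p[unfolded scaled_toric_variety_def]])
    show "(\<lambda>p. p (col i 1) * p (col l 0) - p (col l 1) * p (col i 0)) \<in> polynomial_functions N"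
      using cols by (intro polynomial_functions_diff polynomial_functions.intros) auto
    fix y assume "y \<in> monomial_map (Suc D) N B (prism_scaling c) ` ((- {0}) \<times> torus (Suc D))"
    then obtain s \<theta> where "\<theta> \<in> torus (Suc D)" "y = monomial_map (Suc D) N B (prism_scaling c) (s, \<theta>)"
      by auto
    then show "y (col i 1) * y (col l 0) - y (col l 1) * y (col i 0) = 0"
      by (simp add: monomial_map_prism facts torus_def)
  qed
  then show "p (col i 1) * p (col l 0) = p (col l 1) * p (col i 0)" by simp
qed

text \<open>
  The projection to the base is taken from level $0$ and not from the fibre sums: the latter send
  the parametrised points with $\tau=-1$ to $0$, which is not parametrised.  The free factor
  \<open>\<kappa>\<close> later turns the level-$0$ coordinates into the fibre sums of a given point.
\<close>

lemma prism_toric_middle: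
  assumes p: "p \<in> scaled_toric_variety (Suc D) N B (prism_scaling c)" and "\<kappa> \<noteq> 0"
  shows "(\<lambda>i. if i < n then \<kappa> * p (col i 0) else 0) \<in> scaled_toric_variety D n A c"
  unfolding scaled_toric_variety_def
proof (rule zariski_closure_image[OF p[unfolded scaled_toric_variety_def]])
  show "(\<lambda>p. if i < n then \<kappa> * p (col i 0) else 0) \<in> polynomial_functions N" if "i < n" for i
    using that col_less by (simp add: polynomial_functions_scale_coord)
  fix y assume "y \<in> monomial_map (Suc D) N B (prism_scaling c) ` ((- {0}) \<times> torus (Suc D))"
  then obtain s \<theta> where *: "s \<noteq> 0" "\<theta> \<in> torus (Suc D)"
    "y = monomial_map (Suc D) N B (prism_scaling c) (s, \<theta>)" by auto
  have "(\<lambda>i. if i < n then \<kappa> * y (col i 0) else 0) = monomial_map D n A c (\<kappa> * 2 * s, \<theta>(D := 0))"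
    by (rule ext) (simp add: * monomial_map_prism col_less base_col level_col, simp add: monomial_map_def)
  moreover have "\<theta>(D := 0) \<in> torus D" using *(2) by (auto simp: torus_def coord_space_def)
  ultimately show "(\<lambda>i. if i < n then \<kappa> * y (col i 0) else 0)
      \<in> monomial_map D n A c ` ((- {0}) \<times> torus D)"
    using * assms(2) by (intro rev_image_eqI[of "(\<kappa> * 2 * s, \<theta>(D := 0))"]) auto
qed (simp add: coord_space_def)

text \<open>
  The factors over the levels $-1, 0, 1$ are the terms of $(b + a)^2$.  If $a + b = 1$, they
  distribute each \<open>q i\<close> over its fibre without changing the fibre sum.
\<close>

definition binomial_lift :: "complex \<Rightarrow> complex \<Rightarrow> (nat \<Rightarrow> complex) \<Rightarrow> nat \<Rightarrow> complex" where
  "binomial_lift a b q j =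
     (if j < N then (if level j = 1 then a\<^sup>2 else if level j = 0 then 2 * a * b else b\<^sup>2) * q (base j) else 0)"

text \<open>
  The factors $a^2, 2ab, b^2$ are $ab$ times $\tau, 2, \tau^{-1}$ for $\tau=a/b$, so lifting a
  parametrised point means putting \<open>a / b\<close> for the new parameter and rescaling $s$ by $ab$.
\<close>

lemma binomial_lift_toric:
  assumes q: "q \<in> scaled_toric_variety D n A c" and "a \<noteq> 0" "b \<noteq> 0"
  shows "binomial_lift a b q \<in> scaled_toric_variety (Suc D) N B (prism_scaling c)"
  unfolding scaled_toric_variety_def
proof (rule zariski_closure_image[OF q[unfolded scaled_toric_variety_def]])
  show "(\<lambda>q. binomial_lift a b q j) \<in> polynomial_functions n" if "j < N" for j
    using that base_less by (simp add: binomial_lift_def polynomial_functions_scale_coord)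
  fix y assume "y \<in> monomial_map D n A c ` ((- {0}) \<times> torus D)"
  then obtain s \<theta> where *: "s \<noteq> 0" "\<theta> \<in> torus D" "y = monomial_map D n A c (s, \<theta>)" by auto
  have \<theta>: "\<theta>(D := 0) = \<theta>" using *(2) by (auto simp: torus_def coord_space_def)
  have y: "monomial_map D n A c (a * b * s, \<theta>) i = a * b * y i" for i
    by (simp add: * monomial_map_def)
  have "binomial_lift a b y j = monomial_map (Suc D) N B (prism_scaling c) (a * b * s, \<theta>(D := a / b)) j" for j
  proof (cases "j < N")
    case True
    then show ?thesis
      using level_cases[OF True] assms(2,3)
      by (auto simp: binomial_lift_def monomial_map_prism y \<theta> power_int_minus power2_eq_square)
  qed (simp add: binomial_lift_def monomial_map_def)
  then have "binomial_lift a b y = monomial_map (Suc D) N B (prism_scaling c) (a * b * s, \<theta>(D := a / b))"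
    by (rule ext)
  moreover have "\<theta>(D := a / b) \<in> torus (Suc D)"
    using *(2) assms by (auto simp: torus_def coord_space_def)
  ultimately show "binomial_lift a b y
      \<in> monomial_map (Suc D) N B (prism_scaling c) ` ((- {0}) \<times> torus (Suc D))"
    using * assms by (intro rev_image_eqI[of "(a * b * s, \<theta>(D := a / b))"]) auto
qed (simp add: coord_space_def binomial_lift_def)

lemma binomial_lift_torus:
  "q \<in> torus n \<Longrightarrow> a \<noteq> 0 \<Longrightarrow> b \<noteq> 0 \<Longrightarrow> binomial_lift a b q \<in> torus N"
  using base_less by (auto simp: torus_def coord_space_def binomial_lift_def)

lemma marginal_binomial_lift:
  assumes "q \<in> coord_space n" "a + b = 1"
  shows "marginal (binomial_lift a b q) = q"
proof
  fix i
  show "marginal (binomial_lift a b q) i = q i"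
  proof (cases "i < n")
    case True
    then have "marginal (binomial_lift a b q) i = (a + b)\<^sup>2 * q i"
      by (simp add: marginal_fibre binomial_lift_def col_less base_col level_col)
        (simp add: power2_eq_square algebra_simps)
    then show ?thesis using assms(2) by simp
  next
    case False
    then show ?thesis using marginal_coord_space[of "binomial_lift a b q"] assms(1)
      by (simp add: coord_space_def)
  qed
qed


section \<open>The score equations of a prism\<close>

lemma sum_level:
  fixes x :: "nat \<Rightarrow> complex"
  shows "(\<Sum>j<N. of_int (level j) * x j) = (\<Sum>i<n. x (col i 1) - x (col i (-1)))"
proof -
  have "(\<Sum>j<N. of_int (level j) * x j) = (\<Sum>i<n. marginal (\<lambda>j. of_int (level j) * x j) i)"
    by (simp add: sum_marginal_1)
  also have "\<dots> = (\<Sum>i<n. x (col i 1) - x (col i (-1)))"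
    by (intro sum.cong refl) (simp add: marginal_fibre level_col)
  finally show ?thesis .
qed

lemma sum_level_binomial_lift:
  assumes "a + b = 1"
  shows "(\<Sum>j<N. of_int (level j) * binomial_lift a b q j) = (a - b) * (\<Sum>i<n. q i)"
proof -
  have "a\<^sup>2 - b\<^sup>2 = a - b" using assms by (simp add: power2_eq_square square_diff_square_factored)
  then have "a\<^sup>2 * x - b\<^sup>2 * x = (a - b) * x" for x by (metis left_diff_distrib)
  then show ?thesis
    by (simp add: sum_level binomial_lift_def col_less base_col level_col sum_distrib_left)
qed

text \<open>
  All rows of the prism's matrix except the last are constant on fibres, so they only see fibre sums.
\<close>

lemma score_solutions_prism:
  "score_solutions (Suc D) N B c' u =
    {p \<in> scaled_toric_variety (Suc D) N B c' \<inter> torus N.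
      (\<forall>i<D+1. (\<Sum>j<n. of_int (add_ones_row A i j) * marginal p j) =
        1 / of_nat (\<Sum>j<n. marginal u j) * (\<Sum>j<n. of_int (add_ones_row A i j) * of_nat (marginal u j))) \<and>
      (\<Sum>j<N. of_int (level j) * p j) = (\<Sum>j<N. of_int (level j) * of_nat (u j)) / of_nat (\<Sum>j<N. u j)}"
proof -
  have row: "(\<Sum>j<N. of_int (add_ones_row B i j) * x j) = (\<Sum>j<n. of_int (add_ones_row A i j) * marginal x j)"
    if "i < D + 1" for i and x :: "nat \<Rightarrow> complex"
  proof -
    have "add_ones_row B i j = add_ones_row A i (base j)" if "j < N" for j
      using that \<open>i < D + 1\<close> by (auto simp: add_ones_row_def lower_rows split: nat.split)
    then show ?thesis by (simp add: sum_marginal)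
  qed
  have last: "(\<Sum>j<N. of_int (add_ones_row B (Suc D) j) * x j) = (\<Sum>j<N. of_int (level j) * x j)"
    for x :: "nat \<Rightarrow> complex"
    by (simp add: add_ones_row_def last_row)
  show ?thesis
    unfolding score_solutions_def
    by (simp add: All_less_Suc row last of_nat_marginal sum_marginal_1 del: of_nat_sum)
      (auto simp: less_Suc_eq row)
qed

text \<open>
  Write \<open>x i\<close> for half the level-$0$ coordinate over \<open>i\<close>.  The binomials of the
  prism give a common $\tau$ with coordinates $x_i/\tau, 2x_i, \tau x_i$ over $i$.  As the
  coordinates sum to $1$, the factor $(1+\tau)^2/\tau$ is nonzero, and dividing the equation of the
  last row by the one of the first gives $a-b=(\tau-1)/(\tau+1)$, that is
  $a=\tau/(1+\tau)$ and $b=1/(1+\tau)$.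
\<close>

lemma prism_solution_is_binomial_lift:
  assumes p: "p \<in> scaled_toric_variety (Suc D) N B (prism_scaling c)" "p \<in> torus N"
    and total: "(\<Sum>i<n. marginal p i) = 1"
    and level: "(\<Sum>j<N. of_int (level j) * p j) = a - b" and ab: "a + b = 1"
  shows "p = binomial_lift a b (marginal p)"
    and "marginal p \<in> scaled_toric_variety D n A c" and "marginal p \<in> torus n"
proof -
  have "n \<noteq> 0" using total by (intro notI) simp
  define x where "x i = p (col i 0) / 2" for i
  define \<tau> where "\<tau> = p (col 0 1) / x 0"
  have nz: "p (col i e) \<noteq> 0" if "i < n" "e \<in> {-1,0,1}" for i e
    using p(2) col_less that by (simp add: torus_def)
  have x_nz: "x i \<noteq> 0" if "i < n" for i using nz that by (simp add: x_def)
  have \<tau>_nz: "\<tau> \<noteq> 0" using nz x_nz \<open>n \<noteq> 0\<close> by (simp add: \<tau>_def)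
  have up: "p (col i 1) = \<tau> * x i" if "i < n" for i
    using prism_toric_fibre(2)[OF p(1) that, of 0] \<open>n \<noteq> 0\<close> nz[of 0 0]
    by (simp add: \<tau>_def x_def field_simps)
  have down: "p (col i (-1)) = x i / \<tau>" if "i < n" for i
  proof -
    have "\<tau> * x i * p (col i (-1)) = x i * x i"
      using prism_toric_fibre(1)[OF p(1) that that] up[OF that] by (simp add: x_def power2_eq_square)
    then show ?thesis using x_nz[OF that] \<tau>_nz by (simp add: field_simps)
  qed
  have marg: "marginal p i = (\<tau> + 1)\<^sup>2 / \<tau> * x i" if "i < n" for i
  proof -
    have "marginal p i = x i / \<tau> + 2 * x i + \<tau> * x i"
      using that by (simp add: marginal_fibre up down) (simp add: x_def)
    then show ?thesis using \<tau>_nz by (simp add: field_simps power2_eq_square)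
  qed
  define X where "X = (\<Sum>i<n. x i)"
  have one: "(\<tau> + 1)\<^sup>2 / \<tau> * X = 1"
    using total marg by (simp add: X_def sum_distrib_left)
  then have \<tau>1: "\<tau> + 1 \<noteq> 0" by auto
  have "a - b = (\<Sum>i<n. \<tau> * x i - x i / \<tau>)"
    using level by (simp only: sum_level) (simp add: up down)
  then have "a - b = (\<tau> - 1 / \<tau>) * X"
    by (simp add: X_def sum_distrib_left left_diff_distrib)
  moreover have "X = \<tau> / (\<tau> + 1)\<^sup>2" using one \<tau>1 \<tau>_nz by (simp add: field_simps)
  ultimately have "a - b = (\<tau> - 1 / \<tau>) * \<tau> / (\<tau> + 1)\<^sup>2" by simp
  also have "(\<tau> - 1 / \<tau>) * \<tau> = (\<tau> - 1) * (\<tau> + 1)" using \<tau>_nz by (simp add: field_simps)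
  also have "(\<tau> - 1) * (\<tau> + 1) / (\<tau> + 1)\<^sup>2 = (\<tau> - 1) / (\<tau> + 1)" using \<tau>1 by (simp add: power2_eq_square)
  finally have "a - b = (\<tau> - 1) / (\<tau> + 1)" .
  moreover have "2 * a = (a + b) + (a - b)" "2 * b = (a + b) - (a - b)" by simp_all
  ultimately have "2 * a = 1 + (\<tau> - 1) / (\<tau> + 1)" "2 * b = 1 - (\<tau> - 1) / (\<tau> + 1)"
    using ab by simp_all
  moreover have "1 + (\<tau> - 1) / (\<tau> + 1) = 2 * (\<tau> / (\<tau> + 1))"
    "1 - (\<tau> - 1) / (\<tau> + 1) = 2 * (1 / (\<tau> + 1))"
    using \<tau>1 by (simp_all add: field_simps)
  ultimately have "2 * a = 2 * (\<tau> / (\<tau> + 1))" "2 * b = 2 * (1 / (\<tau> + 1))" by (simp_all only:)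
  then have a: "a = \<tau> / (\<tau> + 1)" and b: "b = 1 / (\<tau> + 1)"
    unfolding mult_cancel_left by simp_all
  have weights: "x i = a * b * marginal p i" "\<tau> * x i = a\<^sup>2 * marginal p i" "x i / \<tau> = b\<^sup>2 * marginal p i"
    if "i < n" for i
    using \<tau>1 \<tau>_nz by (simp_all add: marg[OF that] a b power2_eq_square)
  show "p = binomial_lift a b (marginal p)"
  proof
    fix j
    show "p j = binomial_lift a b (marginal p) j"
    proof (cases "j < N")
      case True
      have i: "base j < n" using True by (rule base_less)
      have "p j = p (col (base j) (level j))" using True by (simp add: col_base_level)
      moreover have "p (col (base j) 0) = 2 * x (base j)" by (simp add: x_def)
      ultimately show ?thesis
        using level_cases[OF True] True weights[OF i] up[OF i] down[OF i]
        by (auto simp: binomial_lift_def)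
    next
      case False
      then show ?thesis using p(2) by (simp add: binomial_lift_def torus_def coord_space_def)
    qed
  qed
  let ?\<kappa> = "(\<tau> + 1)\<^sup>2 / \<tau> / 2"
  have "marginal p = (\<lambda>i. if i < n then ?\<kappa> * p (col i 0) else 0)"
    using marginal_coord_space[of p] by (auto simp: marg x_def coord_space_def)
  moreover have "?\<kappa> \<noteq> 0" using \<tau>1 \<tau>_nz by simp
  ultimately show "marginal p \<in> scaled_toric_variety D n A c"
    using prism_toric_middle[OF p(1), of ?\<kappa>] by simp
  show "marginal p \<in> torus n"
    using marginal_coord_space[of p] x_nz \<tau>1 \<tau>_nz by (simp add: torus_def marg)
qed

text \<open>
  Positivity of the data ensures $|v|<1$ for the mean level $v$, so that neither $a=(1+v)/2$ nor
  $b=(1-v)/2$ vanishes and lifted points stay in the torus.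
\<close>

lemma bij_betw_score_solutions_prism:
  assumes "n > 0" and u: "\<And>j. j < N \<Longrightarrow> u j > 0"
  shows "bij_betw marginal (score_solutions (Suc D) N B (prism_scaling c) u)
           (score_solutions D n A c (marginal u))"
proof -
  define S :: complex where "S = of_nat (\<Sum>j<N. u j)"
  define v where "v = (\<Sum>j<N. of_int (level j) * of_nat (u j)) / S"
  define a b where "a = (1 + v) / 2" and "b = (1 - v) / 2"
  have ab: "a + b = 1" "a - b = v" by (simp_all add: a_def b_def field_simps)
  have c0: "col 0 0 < N" using \<open>n > 0\<close> col_less by simp
  have lv: "\<bar>of_int (level j)\<bar> \<le> (1::real)" if "j < N" for j using level_cases[OF that] by auto
  define Lr :: real where "Lr = (\<Sum>j<N. of_int (level j) * of_nat (u j))"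
  define Sr :: real where "Sr = (\<Sum>j<N. of_nat (u j))"
  have "\<bar>Lr\<bar> < Sr"
  proof -
    have "\<bar>Lr\<bar> \<le> (\<Sum>j<N. \<bar>of_int (level j) * of_nat (u j)\<bar>)" unfolding Lr_def by (rule sum_abs)
    also have "\<dots> < Sr" unfolding Sr_def
    proof (rule sum_strict_mono_ex1)
      show "\<forall>j\<in>{..<N}. \<bar>of_int (level j) * of_nat (u j)\<bar> \<le> (of_nat (u j) :: real)"
        using lv by (auto simp: abs_mult intro!: mult_left_le_one_le)
      \<comment> \<open>Level $0$ contributes to the total but not to the weighted sum, hence strictness.\<close>
      show "\<exists>j\<in>{..<N}. \<bar>of_int (level j) * of_nat (u j)\<bar> < (of_nat (u j) :: real)"
        using c0 u \<open>n > 0\<close> by (intro bexI[of _ "col 0 0"]) (auto simp: level_col)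
    qed simp
    finally show ?thesis .
  qed
  have S: "S = of_real Sr" by (simp add: S_def Sr_def)
  have v: "v = of_real (Lr / Sr)" by (simp add: v_def S Lr_def)
  have "S \<noteq> 0" using \<open>\<bar>Lr\<bar> < Sr\<close> by (simp add: S)
  have "Lr / Sr < 1" "Lr / Sr > - 1" using \<open>\<bar>Lr\<bar> < Sr\<close> by (auto simp: field_simps)
  then have "1 + Lr / Sr \<noteq> 0" "1 - Lr / Sr \<noteq> 0" by auto
  then have nz: "a \<noteq> 0" "b \<noteq> 0"
    unfolding a_def b_def v by (metis divide_eq_0_iff of_real_1 of_real_add of_real_diff of_real_eq_0_iff zero_neq_numeral)+
  have total: "(\<Sum>i<n. q i) = 1"
    if "\<forall>i<D+1. (\<Sum>j<n. of_int (add_ones_row A i j) * q j) =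
        1 / of_nat (\<Sum>j<n. marginal u j) * (\<Sum>j<n. of_int (add_ones_row A i j) * of_nat (marginal u j))"
    for q :: "nat \<Rightarrow> complex"
  proof -
    have "(\<Sum>i<n. q i) = 1 / S * S"
      using that[rule_format, of 0] unfolding S_def
      by (simp add: add_ones_row_def sum_marginal_1 flip: of_nat_sum)
    then show ?thesis using \<open>S \<noteq> 0\<close> by simp
  qed
  show ?thesis
  proof (rule bij_betw_byWitness[where f' = "binomial_lift a b"])
    show "\<forall>p\<in>score_solutions (Suc D) N B (prism_scaling c) u. binomial_lift a b (marginal p) = p"
      using prism_solution_is_binomial_lift(1)[OF _ _ total _ ab(1)]
      by (auto simp: score_solutions_prism ab v_def S_def)
    show "\<forall>q\<in>score_solutions D n A c (marginal u). marginal (binomial_lift a b q) = q"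
      by (auto simp: score_solutions_def torus_def intro!: marginal_binomial_lift ab)
    show "marginal ` score_solutions (Suc D) N B (prism_scaling c) u \<subseteq> score_solutions D n A c (marginal u)"
    proof
      fix q assume "q \<in> marginal ` score_solutions (Suc D) N B (prism_scaling c) u"
      then obtain p where p: "p \<in> score_solutions (Suc D) N B (prism_scaling c) u" and q: "q = marginal p"
        by blast
      then show "q \<in> score_solutions D n A c (marginal u)"
        using prism_solution_is_binomial_lift(2,3)[OF _ _ total _ ab(1), of p c]
        unfolding score_solutions_prism by (auto simp: score_solutions_def ab v_def S_def)
    qed
    show "binomial_lift a b ` score_solutions D n A c (marginal u) \<subseteq> score_solutions (Suc D) N B (prism_scaling c) u"
    proof
      fix p assume "p \<in> binomial_lift a b ` score_solutions D n A c (marginal u)"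
      then obtain q where q: "q \<in> score_solutions D n A c (marginal u)" and p: "p = binomial_lift a b q"
        by blast
      have m: "marginal p = q"
        using q p by (auto simp: score_solutions_def torus_def intro!: marginal_binomial_lift ab)
      have "(\<Sum>j<N. of_int (level j) * p j) = v"
        using q total[of q] sum_level_binomial_lift[OF ab(1), of q] by (simp add: p ab score_solutions_def)
      moreover have "p \<in> scaled_toric_variety (Suc D) N B (prism_scaling c) \<inter> torus N"
        using q nz by (auto simp: p score_solutions_def intro: binomial_lift_toric binomial_lift_torus)
      ultimately show "p \<in> score_solutions (Suc D) N B (prism_scaling c) u"
        using q unfolding score_solutions_prism by (simp add: m v_def S_def score_solutions_def)
    qed
  qed
qed

text \<open>
  The number of solutions agrees generically for every candidate value, so the two definite
  descriptions of the ML degree have the same defining property.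
\<close>

lemma mldeg_prism:
  assumes "n > 0"
  shows "mldeg (Suc D) N B (prism_scaling c) = mldeg D n A c"
proof -
  have "generically N (\<lambda>u. finite (score_solutions (Suc D) N B (prism_scaling c) u) \<and>
            card (score_solutions (Suc D) N B (prism_scaling c) u) = m) \<longleftrightarrow>
        generically n (\<lambda>u. finite (score_solutions D n A c u) \<and> card (score_solutions D n A c u) = m)" for m
  proof (rule generically_marginal_iff)
    fix u :: "nat \<Rightarrow> nat"
    assume "\<And>j. j < N \<Longrightarrow> u j > 0"
    then have "bij_betw marginal (score_solutions (Suc D) N B (prism_scaling c) u)
           (score_solutions D n A c (marginal u))"
      using assms by (intro bij_betw_score_solutions_prism)
    then show "(finite (score_solutions (Suc D) N B (prism_scaling c) u) \<and>
            card (score_solutions (Suc D) N B (prism_scaling c) u) = m) \<longleftrightarrow>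
        (finite (score_solutions D n A c (marginal u)) \<and> card (score_solutions D n A c (marginal u)) = m)"
      using bij_betw_finite bij_betw_same_card by metis
  qed (simp add: score_solutions_scale)
  then show ?thesis unfolding mldeg_def by simp
qed

end


section \<open>Lattice points of a prism\<close>

definition column :: "nat \<Rightarrow> (nat \<Rightarrow> nat \<Rightarrow> int) \<Rightarrow> nat \<Rightarrow> nat \<Rightarrow> real" where
  "column d A j = (\<lambda>i. if i < d then real_of_int (A i j) else 0)"

lemma is_design_matrix_iff: "is_design_matrix d n A P \<longleftrightarrow> bij_betw (column d A) {..<n} (P \<inter> lattice d)"
  by (simp add: is_design_matrix_def column_def[abs_def])

lemma prism_lattice_iff:
  assumes "P \<subseteq> coord_space d"
  shows "y \<in> prism d P \<inter> lattice (Suc d) \<longleftrightarrow>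
    y(d := 0) \<in> P \<inter> lattice d \<and> y d \<in> {-1, 0, 1}"
proof
  assume y: "y \<in> prism d P \<inter> lattice (Suc d)"
  then obtain x t where x: "x \<in> P" "-1 \<le> t" "t \<le> 1" "y = x(d := t)"
    by (auto simp: prism_def)
  moreover from this have "x d = 0" using assms by (auto simp: coord_space_def)
  ultimately have "y(d := 0) = x" by auto
  moreover have "y(d := 0) \<in> lattice d" using y by (auto simp: lattice_def coord_space_def)
  moreover have "y d \<in> {-1, 0, 1}"
  proof -
    have "y d \<in> \<int>" using y by (simp add: lattice_def)
    then obtain m where "y d = of_int m" by (auto elim: Ints_cases)
    moreover from this have "-1 \<le> m" "m \<le> 1" using x by auto
    ultimately show ?thesis by (cases "m = 0"; cases "m = 1"; cases "m = -1") auto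
  qed
  ultimately show "y(d := 0) \<in> P \<inter> lattice d \<and> y d \<in> {-1, 0, 1}" using x by simp
next
  assume *: "y(d := 0) \<in> P \<inter> lattice d \<and> y d \<in> {-1, 0, 1}"
  have "y \<in> prism d P"
    unfolding prism_def
    by (rule CollectI, rule exI[of _ "y(d := 0)"], rule exI[of _ "y d"]) (use * in auto)
  moreover have "y \<in> lattice (Suc d)"
  proof -
    have l: "y(d := 0) \<in> lattice d" using * by simp
    have "y i = 0" if "i \<ge> Suc d" for i
      using l that by (auto simp: lattice_def coord_space_def dest: spec[of _ i])
    moreover have "y i \<in> \<int>" if "i < Suc d" for i
    proof (cases "i = d")
      case False
      then show ?thesis using l that by (auto simp: lattice_def less_Suc_eq dest: spec[of _ i])
    qed (use * in auto)
    ultimately show ?thesis by (simp add: lattice_def coord_space_def)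
  qed
  ultimately show "y \<in> prism d P \<inter> lattice (Suc d)" by simp
qed

lemma design_matrix_of_prism:
  assumes P: "P \<subseteq> coord_space d" and A: "is_design_matrix d n A P"
    and B: "is_design_matrix (Suc d) N B (prism d P)"
  obtains base level where "prism_design d n N A B base level"
proof -
  note A = A[unfolded is_design_matrix_iff] and B = B[unfolded is_design_matrix_iff]
  have drop: "(column (Suc d) B j)(d := 0) = column d B j" for j
    by (auto simp: column_def)
  have at: "column (Suc d) B j d = real_of_int (B d j)" for j
    by (simp add: column_def)
  have mem: "column d B j \<in> P \<inter> lattice d \<and> B d j \<in> {-1, 0, 1}" if "j < N" for j
  proof -
    have "column (Suc d) B j \<in> prism d P \<inter> lattice (Suc d)"
      using B that by (auto simp: bij_betw_def)
    then have *: "column d B j \<in> P \<inter> lattice d \<and> real_of_int (B d j) \<in> {-1, 0, 1}"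
      unfolding prism_lattice_iff[OF P] drop at .
    then have "real_of_int (B d j) = real_of_int (-1) \<or> real_of_int (B d j) = real_of_int 0
        \<or> real_of_int (B d j) = real_of_int 1" by simp
    then have "B d j \<in> {-1, 0, 1}" unfolding of_int_eq_iff by simp
    then show ?thesis using * by blast
  qed
  have "\<exists>i<n. column d A i = column d B j" if "j < N" for j
  proof -
    have "column d B j \<in> column d A ` {..<n}"
      using mem[OF that] A by (simp add: bij_betw_def)
    then show ?thesis by auto
  qed
  then obtain base where base: "\<And>j. j < N \<Longrightarrow> base j < n \<and> column d A (base j) = column d B j"
    by metis
  have "prism_design d n N A B base (B d)"
  proof
    show "bij_betw (\<lambda>j. (base j, B d j)) {..<N} ({..<n} \<times> {-1, 0, 1})"
      unfolding bij_betw_def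
    proof (intro conjI inj_onI subset_antisym)
      show "(\<lambda>j. (base j, B d j)) ` {..<N} \<subseteq> {..<n} \<times> {-1, 0, 1}" using mem base by blast
    next
      fix j l assume jl: "j \<in> {..<N}" "l \<in> {..<N}" "(base j, B d j) = (base l, B d l)"
      then have "column d B j = column d B l" using base[of j] base[of l] by auto
      then have "column (Suc d) B j i = column (Suc d) B l i" for i
        using jl(3) by (auto simp: column_def fun_eq_iff less_Suc_eq split: if_splits)
      then have "column (Suc d) B j = column (Suc d) B l" by (rule ext)
      then show "j = l" using B jl by (auto simp: bij_betw_def inj_on_def)
    next
      show "{..<n} \<times> {-1, 0, 1} \<subseteq> (\<lambda>j. (base j, B d j)) ` {..<N}"
      proof
        fix z assume "z \<in> {..<n} \<times> {-1, 0, 1::int}"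
        then obtain i e where z: "z = (i, e)" "i < n" "e \<in> {-1, 0, 1}" by auto
        have i: "column d A i \<in> P \<inter> lattice d" using A z by (auto simp: bij_betw_def)
        define y where "y = (column d A i)(d := real_of_int e)"
        have "y(d := 0) = column d A i" by (auto simp: y_def column_def)
        then have "y \<in> prism d P \<inter> lattice (Suc d)"
          unfolding prism_lattice_iff[OF P] using i z by (auto simp: y_def)
        then obtain j where j: "j < N" "y = column (Suc d) B j"
          using B by (auto simp: bij_betw_def)
        have "column d A (base j) = column d A i"
          using base[OF j(1)] drop[of j] \<open>y(d := 0) = column d A i\<close> j(2) by simp
        then have "base j = i" using A base[OF j(1)] z by (auto simp: bij_betw_def inj_on_def)
        moreover have "B d j = e" using at[of j] by (simp flip: j(2)) (simp add: y_def)
        ultimately show "z \<in> (\<lambda>j. (base j, B d j)) ` {..<N}" using j z by auto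
      qed
    qed
    show "B i j = A i (base j)" if "i < d" "j < N" for i j
    proof -
      have "column d A (base j) i = column d B j i" using base[OF that(2)] by simp
      then show ?thesis using that(1) by (simp add: column_def)
    qed
  qed simp
  then show thesis by (rule that)
qed

lemma design_matrix_exists:
  assumes "finite (P \<inter> lattice d)"
  obtains n A where "is_design_matrix d n A P"
proof -
  obtain h where h: "bij_betw h {0..<card (P \<inter> lattice d)} (P \<inter> lattice d)"
    using ex_bij_betw_nat_finite[OF assms] by blast
  let ?A = "\<lambda>i j. \<lfloor>h j i\<rfloor>"
  have "column d ?A j = h j" if "j < card (P \<inter> lattice d)" for j
  proof
    fix i
    have "h j \<in> lattice d" using h that by (auto simp: bij_betw_def)
    then show "column d ?A j i = h j i"
      by (auto simp: column_def lattice_def coord_space_def of_int_floor_cancel)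
  qed
  then have "is_design_matrix d (card (P \<inter> lattice d)) ?A P"
    unfolding is_design_matrix_iff using h
    by (subst bij_betw_cong[where g = h]) (auto simp: lessThan_atLeast0)
  then show thesis by (rule that)
qed

lemma design_matrix_nonempty:
  assumes "is_design_matrix d n A P" "P \<inter> lattice d \<noteq> {}"
  shows "n > 0"
  using assms by (cases n) (auto simp: is_design_matrix_iff bij_betw_def)

lemma finite_lattice_points_base:
  assumes P: "P \<subseteq> coord_space d" and B: "is_design_matrix (Suc d) N B (prism d P)"
  shows "finite (P \<inter> lattice d)"
proof (rule finite_subset)
  show "P \<inter> lattice d \<subseteq> prism d P \<inter> lattice (Suc d)"
  proof
    fix x assume x: "x \<in> P \<inter> lattice d"
    then have "x d = 0" by (auto simp: lattice_def coord_space_def)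
    moreover from this have "x(d := 0) = x" by auto
    ultimately show "x \<in> prism d P \<inter> lattice (Suc d)"
      unfolding prism_lattice_iff[OF P] using x by simp
  qed
  show "finite (prism d P \<inter> lattice (Suc d))"
    using B bij_betw_finite unfolding is_design_matrix_iff by blast
qed


section \<open>Iterated prisms\<close>

lemma iterated_prism_coord_space:
  "P \<subseteq> coord_space d \<Longrightarrow> iterated_prism d k P \<subseteq> coord_space (d + k)"
  by (induction k) (auto simp: prism_def coord_space_def)

lemma iterated_prism_lattice_nonempty:
  assumes "P \<subseteq> coord_space d" "P \<inter> lattice d \<noteq> {}"
  shows "iterated_prism d k P \<inter> lattice (d + k) \<noteq> {}"
proof (induction k)
  case (Suc k)
  then obtain x where x: "x \<in> iterated_prism d k P \<inter> lattice (d + k)" by blast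
  then have "x (d + k) = 0" by (auto simp: lattice_def coord_space_def)
  moreover from this have "x(d + k := 0) = x" by auto
  ultimately have "x \<in> prism (d + k) (iterated_prism d k P) \<inter> lattice (Suc (d + k))"
    unfolding prism_lattice_iff[OF iterated_prism_coord_space[OF assms(1)]] using x by simp
  then show ?case by auto
qed (use assms in simp)

lemma lattice_polytope_coord_space:
  assumes "lattice_polytope d P"
  shows "P \<subseteq> coord_space d"
proof -
  obtain V where V: "V \<subseteq> lattice d" "P = convex hull V"
    using assms by (auto simp: lattice_polytope_def)
  have "convex (coord_space d :: (nat \<Rightarrow> real) set)"
    by (auto simp: convex_def coord_space_def scaleR_fun_def)
  moreover have "V \<subseteq> coord_space d" using V by (auto simp: lattice_def)
  ultimately show ?thesis unfolding V by (intro hull_minimal)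
qed

lemma lattice_polytope_has_lattice_point:
  assumes "lattice_polytope d P" "has_aff_dim P m"
  shows "P \<inter> lattice d \<noteq> {}"
proof -
  obtain V where V: "V \<subseteq> lattice d" "P = convex hull V"
    using assms by (auto simp: lattice_polytope_def)
  have "P \<noteq> {}" using assms(2) by (auto simp: has_aff_dim_def affine_hull_empty)
  then have "V \<noteq> {}" using V by auto
  then show ?thesis using V hull_subset[of V convex] by blast
qed

text \<open>
  The intermediate prisms come without a design matrix; any enumeration of their lattice points will
  do, because the single step allows arbitrary orders of the columns on both sides.  The induction starts
  at one step rather than none, where two different enumerations of the same lattice points would
  have to be compared.
\<close>

lemma mldeg_iterated_prism:
  assumes P: "P \<subseteq> coord_space d" and ne: "P \<inter> lattice d \<noteq> {}"
    and A: "is_design_matrix d n A P" and c: "c \<in> torus n"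
    and B: "is_design_matrix (d + Suc k) N B (iterated_prism d (Suc k) P)"
  shows "\<exists>c' \<in> torus N. mldeg (d + Suc k) N B c' = mldeg d n A c"
proof -
  have step: "\<exists>c' \<in> torus N'. mldeg (Suc (d + k)) N' B' c' = mldeg (d + k) n' A' c"
    if step: "is_design_matrix (d + k) n' A' (iterated_prism d k P)" "c \<in> torus n'"
      "is_design_matrix (Suc (d + k)) N' B' (prism (d + k) (iterated_prism d k P))" for k n' N' A' B' c
  proof -
    obtain base level where "prism_design (d + k) n' N' A' B' base level"
      using design_matrix_of_prism[OF iterated_prism_coord_space[OF P] step(1,3)] .
    then interpret prism_design "d + k" n' N' A' B' base level .
    have "n' > 0"
      using design_matrix_nonempty[OF step(1) iterated_prism_lattice_nonempty[OF P ne]] .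
    then show ?thesis using mldeg_prism prism_scaling_torus step(2) by blast
  qed
  show ?thesis using B
  proof (induction k arbitrary: N B)
    case 0
    then show ?case using step[of 0 n A c] A c by simp
  next
    case (Suc k)
    have B: "is_design_matrix (Suc (d + Suc k)) N B (prism (d + Suc k) (iterated_prism d (Suc k) P))"
      using Suc.prems by simp
    obtain n' A' where A': "is_design_matrix (d + Suc k) n' A' (iterated_prism d (Suc k) P)"
      using design_matrix_exists finite_lattice_points_base[OF iterated_prism_coord_space[OF P] B] by blast
    obtain c' where "c' \<in> torus n'" "mldeg (d + Suc k) n' A' c' = mldeg d n A c"
      using Suc.IH[OF A'] by blast
    then show ?case using step[OF A' _ B, of c'] by simp
  qed
qed

theorem theorem7p6:
  fixes d k n N :: nat
    and P :: "(nat \<Rightarrow> real) set"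
    and A A\<^sub>k :: "nat \<Rightarrow> nat \<Rightarrow> int"
  assumes "d \<ge> 1"
    and "lattice_polytope d P"
    and "has_aff_dim P d"
    and "k \<ge> 1"
    and "is_design_matrix d n A P"
    and "is_design_matrix (d + k) N A\<^sub>k (iterated_prism d k P)"
  shows "\<exists>c \<in> torus N. mldeg (d + k) N A\<^sub>k c = mldeg d n A (standard_scaling n)"
proof -
  obtain k' where k: "k = Suc k'" using \<open>k \<ge> 1\<close> by (cases k) auto
  have "standard_scaling n \<in> torus n"
    by (simp add: standard_scaling_def torus_def coord_space_def)
  then show ?thesis
    using mldeg_iterated_prism[OF lattice_polytope_coord_space[OF assms(2)]
        lattice_polytope_has_lattice_point[OF assms(2,3)] assms(5) _ assms(6)[unfolded k]]
    by (simp only: k)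
qed

end
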